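(* Let $p_A,p_B\in(0,1)$, let $\mu_A,\mu_B\ge0$ be real numbers, let $J$ be an integer, and let $\gamma$ be real. Let $\mu_A^*,\mu_B^*,\mu_C^*$ be defined as in the context. If $p_A\ne p_B$, $J\ge2$ and $0<\gamma<1$, then the Parrondo effect is present for the random-mixture strategy with parameter $\gamma$, that is, $$\mu_C^*<\gamma\mu_A^*+(1-\gamma)\mu_B^*.$$
   Context: A two-armed slot machine has arms $A$ and $B$. Excluding the Futurity award, the payouts from each arm are nonnegative and i.i.d.; arm $A$ (resp. $B$) has probability $p_A$ (resp. $p_B$) of a nonzero payout and mean payout $\mu_A$ (resp. $\mu_B$). After $J$ consecutive losses (zero payouts), regardless of the order of play of the two arms, the $J$ lost coins are returned to the player (the Futurity award). Let $q_A:=1-p_A$, $q_B:=1-p_B$. The asymptotic mean payouts per coup, including the Futurity award, from playing arm $A$ only and arm $B$ only are $$\mu_A^*:=\mu_A+J\frac{p_Aq_A^J}{1-q_A^J},\qquad \mu_B^*:=\mu_B+J\frac{p_Bq_B^J}{1-q_B^J}.$$ The random-mixture strategy with parameter $\gamma$, denoted $C=\gamma A+(1-\gamma)B$, plays arm $A$ with probability $\gamma$ and arm $B$ otherwise at each coup. Put $p_C:=\gamma p_A+(1-\gamma)p_B$, $q_C:=1-p_C$, $\mu_C:=\gamma\mu_A+(1-\gamma)\mu_B$. Its asymptotic mean payout per coup, including the Futurity award, is $$\mu_C^*:=\mu_C+J\frac{p_Cq_C^J}{1-q_C^J}.$$ The Parrondo effect is said to be present for the random-mixture strategy with parameter $\gamma$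 if $\mu_C^*<\gamma\mu_A^*+(1-\gamma)\mu_B^*$. *)

theory Defs
  imports Complex_Main
begin

text \<open>
  Asymptotic mean payout per coup, including the Futurity award, of i.i.d. play in which a coup
  has mean payout \<open>\<mu>\<close> and a nonzero payout with probability \<open>p\<close>, when \<open>J\<close> coins are returned after
  \<open>J\<close> consecutive losses.
\<close>
definition mean_payout_star :: "nat \<Rightarrow> real \<Rightarrow> real \<Rightarrow> real" where
  "mean_payout_star J p \<mu> = (let q = 1 - p in \<mu> + real J * ((p * q ^ J) / (1 - q ^ J)))"

definition mix :: "real \<Rightarrow> real \<Rightarrow> real \<Rightarrow> real" where
  "mix \<gamma> a b = \<gamma> * a + (1 - \<gamma>) * b"

definition mixture_payout_star ::
  "nat \<Rightarrow> real \<Rightarrow> real \<Rightarrow> real \<Rightarrow> real \<Rightarrow> real \<Rightarrow> real" where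
  "mixture_payout_star J p\<^sub>A \<mu>\<^sub>A p\<^sub>B \<mu>\<^sub>B \<gamma> =
     mean_payout_star J (mix \<gamma> p\<^sub>A p\<^sub>B) (mix \<gamma> \<mu>\<^sub>A \<mu>\<^sub>B)"

definition parrondo_effect ::
  "nat \<Rightarrow> real \<Rightarrow> real \<Rightarrow> real \<Rightarrow> real \<Rightarrow> real \<Rightarrow> bool" where
  "parrondo_effect J p\<^sub>A \<mu>\<^sub>A p\<^sub>B \<mu>\<^sub>B \<gamma> \<longleftrightarrow>
     mixture_payout_star J p\<^sub>A \<mu>\<^sub>A p\<^sub>B \<mu>\<^sub>B \<gamma>
       < \<gamma> * mean_payout_star J p\<^sub>A \<mu>\<^sub>A + (1 - \<gamma>) * mean_payout_star J p\<^sub>B \<mu>\<^sub>B"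

end

theory Submission
  imports Defs
begin

text \<open>
  The Parrondo effect is strict convexity of the Futurity bonus in the win probability. With
  \<open>q = 1 - p\<close> one has \<open>p q\<^sup>J / (1 - q\<^sup>J) = (1 - q) / (1 - q\<^sup>J) - p\<close>, so up to an affine
  term the bonus is \<open>(1 - q) / (1 - q\<^sup>J)\<close>. Its second derivative is a positive factor times
  \<open>P\<^sub>J = (J - 1) - (J + 1) q + (J + 1) q\<^sup>J - (J - 1) q\<^bsup>J+1\<^esup>\<close>. Here \<open>P\<^sub>1 = 0\<close>, and
  \<open>P\<^bsub>J+1\<^esub> - P\<^sub>J = (1 - q) (1 - (J + 1) q\<^sup>J + J q\<^bsup>J+1\<^esup>)\<close> is positive on \<open>(0, 1)\<close>
  (the last factor is a Bernoulli-type expression with a double zero at \<open>q = 1\<close>), so \<open>P\<^sub>J > 0\<close> for \<open>J \<ge> 2\<close>.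
\<close>

text \<open>The mean value theorem on either side of the intermediate point turns both chord slopes
  into values of \<open>f'\<close>, and positivity of \<open>f''\<close> makes the right slope the
  larger one.\<close>

lemma strictly_convex_if_second_derivative_pos:
  fixes f f' f'' :: "real \<Rightarrow> real"
  assumes "a < b" "0 < t" "t < 1"
    and f: "\<And>x. a \<le> x \<Longrightarrow> x \<le> b \<Longrightarrow> (f has_real_derivative f' x) (at x)"
    and f': "\<And>x. a \<le> x \<Longrightarrow> x \<le> b \<Longrightarrow> (f' has_real_derivative f'' x) (at x)"
    and pos: "\<And>x. a \<le> x \<Longrightarrow> x \<le> b \<Longrightarrow> 0 < f'' x"
  shows "f (t * a + (1 - t) * b) < t * f a + (1 - t) * f b"
proof -
  define c where "c = t * a + (1 - t) * b"
  have ca: "c - a = (1 - t) * (b - a)" and bc: "b - c = t * (b - a)"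
    by (simp_all add: c_def algebra_simps)
  have "0 < c - a" "0 < b - c"
    unfolding ca bc using assms(1-3) by simp_all
  then have "a < c" "c < b" by simp_all
  obtain x where x: "a < x" "x < c" "f c - f a = (c - a) * f' x"
    using MVT2[of a c f f'] f \<open>a < c\<close> \<open>c < b\<close> by (meson less_le_trans order.trans less_imp_le)
  obtain y where y: "c < y" "y < b" "f b - f c = (b - c) * f' y"
    using MVT2[of c b f f'] f \<open>a < c\<close> \<open>c < b\<close> by (meson less_le_trans order.trans less_imp_le)
  have "f' x < f' y"
    using x y by (intro DERIV_pos_imp_increasing[of x y f'])
      (auto intro!: exI[of _ "f'' _"] f' pos)
  \<comment> \<open>The convexity gap \<open>t * f a + (1 - t) * f b - f c\<close> is exactly this
    multiple of the slope difference.\<close>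
  then have "0 < t * (1 - t) * (b - a) * (f' y - f' x)"
    using assms(1-3) by simp
  also have "\<dots> = t * (f a - f c) + (1 - t) * (f b - f c)"
  proof -
    have "f a - f c = - ((1 - t) * (b - a) * f' x)" using x(3) ca by simp
    moreover have "f b - f c = t * (b - a) * f' y" using y(3) bc by simp
    ultimately show ?thesis by (simp only:) (simp add: algebra_simps)
  qed
  finally show ?thesis by (simp add: c_def algebra_simps)
qed

lemma power_double_zero_pos:
  fixes q :: real
  assumes "0 < q" "q < 1"
  shows "0 < 1 - real (Suc n + 1) * q ^ Suc n + real (Suc n) * q ^ (Suc n + 1)"
proof (induction n)
  case 0
  have "0 < (1 - q)\<^sup>2" using assms by simp
  then show ?case by (simp add: power2_eq_square algebra_simps)
next
  case (Suc n)
  \<comment> \<open>This is the increment of the expression from \<open>n\<close> to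
    \<open>Suc n\<close>.\<close>
  have "0 \<le> real (n + 2) * q ^ (n + 1) * (1 - q)\<^sup>2"
    using assms by simp
  with Suc show ?case by (simp add: power2_eq_square algebra_simps)
qed

lemma bonus_second_derivative_numerator_pos:
  fixes q :: real
  assumes "0 < q" "q < 1" "2 \<le> J"
  shows "0 < (real J - 1) - (real J + 1) * q + (real J + 1) * q ^ J - (real J - 1) * q ^ (J + 1)"
  using \<open>2 \<le> J\<close>
proof (induction J rule: dec_induct)
  case base
  \<comment> \<open>For \<open>J = 2\<close> the expression is
    \<open>1 - 3 * q + 3 * q^2 - q^3\<close>, a perfect cube.\<close>
  have "0 < (1 - q) ^ 3" using assms by simp
  then show ?case by (simp add: power3_eq_cube power2_eq_square algebra_simps)
next
  case (step n)
  then obtain m where n: "n = Suc m" by (cases n) auto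
  have "0 < (1 - q) * (1 - real (n + 1) * q ^ n + real n * q ^ (n + 1))"
    using assms power_double_zero_pos[of q m] by (simp add: n)
  with step.IH show ?case by (simp add: algebra_simps)
qed

lemma bonus_strictly_convex:
  fixes a b t :: real
  assumes "0 < a" "a < b" "b < 1" "0 < t" "t < 1" "2 \<le> J"
  defines "f \<equiv> \<lambda>q. (1 - q) / (1 - q ^ J)"
  shows "f (t * a + (1 - t) * b) < t * f a + (1 - t) * f b"
proof -
  \<comment> \<open>Writing \<open>J\<close> as \<open>m + 2\<close> keeps natural-number
    subtraction out of the exponents produced by two differentiations.\<close>
  obtain m where J: "J = Suc (Suc m)"
    using \<open>2 \<le> J\<close> by (metis add_2_eq_Suc le_Suc_ex)
  then have pred_J: "J - Suc 0 = m + 1" by simp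
  define f' where "f' = (\<lambda>q::real. (- (1 - q ^ J) + (1 - q) * (J * q ^ (m + 1))) / (1 - q ^ J)\<^sup>2)"
  define P where "P = (\<lambda>q::real. (real J - 1) - (real J + 1) * q + (real J + 1) * q ^ J
      - (real J - 1) * q ^ (J + 1))"
  have ne: "1 - q ^ J \<noteq> 0" "0 < 1 - q ^ J" if "a \<le> q" "q \<le> b" for q
    using power_less_one_iff[of q J] that assms by auto
  show ?thesis
  proof (rule strictly_convex_if_second_derivative_pos[where f' = f' and
        f'' = "\<lambda>q. real J * q ^ m * P q / (1 - q ^ J) ^ 3"])
    fix q assume q: "a \<le> q" "q \<le> b"
    show "(f has_real_derivative f' q) (at q)"
      unfolding f_def f'_def using ne[OF q] pred_J
      by (auto intro!: derivative_eq_intros simp: power2_eq_square)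
    show "(f' has_real_derivative real J * q ^ m * P q / (1 - q ^ J) ^ 3) (at q)"
    proof -
      define u where "u = q ^ m"
      define d where "d = 1 - q ^ J"
      define n where "n = - d + (1 - q) * (J * (q * u))"
      have pw: "q ^ J = q * q * u" by (simp add: u_def J)
      have Dd: "((\<lambda>x. 1 - x ^ J) has_real_derivative - (J * (q * u))) (at q)"
        using pred_J by (auto intro!: derivative_eq_intros simp: u_def)
      have Dp: "((\<lambda>x. x ^ (m + 1)) has_real_derivative (m + 1) * u) (at q)"
        using DERIV_pow[of "m + 1" q] by (simp add: u_def)
      have "((\<lambda>x. - (1 - x ^ J) + (1 - x) * (J * x ^ (m + 1))) has_real_derivative
          (1 - q) * (J * ((m + 1) * u))) (at q)"
        by (rule derivative_eq_intros Dd Dp refl)+ (simp add: u_def algebra_simps)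
      from DERIV_divide[OF this DERIV_power[OF Dd, of 2]] ne[OF q]
      have "(f' has_real_derivative
          ((1 - q) * (J * ((m + 1) * u)) * d\<^sup>2 + n * (2 * d * (J * (q * u)))) / (d\<^sup>2 * d\<^sup>2)) (at q)"
        unfolding f'_def by (simp add: d_def n_def u_def algebra_simps)
      moreover have "(1 - q) * (J * ((m + 1) * u)) * d\<^sup>2 + n * (2 * d * (J * (q * u)))
          = real J * u * P q * d"
      proof -
        \<comment> \<open>The numerator from the quotient rule has the common factor
          \<open>J * u * d\<close>; what remains is \<open>P q\<close>, and the extra
          \<open>d\<close> reduces the denominator from \<open>d ^ 4\<close> to
          \<open>d ^ 3\<close>.\<close>
        have "(1 - q) * ((m + 1) * d) + 2 * n * q = P q"
          unfolding n_def d_def P_def power_add pw by (simp add: J algebra_simps)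
        then have "real J * u * P q * d = real J * u * ((1 - q) * ((m + 1) * d) + 2 * n * q) * d"
          by simp
        then show ?thesis by (simp add: power2_eq_square algebra_simps)
      qed
      moreover have "real J * u * P q * d / (d\<^sup>2 * d\<^sup>2) = real J * u * P q / d ^ 3"
        using ne[OF q] by (simp add: d_def power2_eq_square power3_eq_cube mult.assoc)
      ultimately show ?thesis by (simp add: u_def d_def)
    qed
    have "0 < P q"
      unfolding P_def using q assms by (intro bonus_second_derivative_numerator_pos) auto
    then show "0 < real J * q ^ m * P q / (1 - q ^ J) ^ 3"
      using q assms ne[OF q] by simp
  qed (use assms in auto)
qed

text \<open>The form \<open>1 - (1 - p)\<close> is kept so that the fraction is visibly the convex
  function evaluated at the loss probability.\<close>

lemma mean_payout_star_eq:
  assumes "0 < p" "p < 1" "0 < J"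
  shows "mean_payout_star J p \<mu> = \<mu> + real J * ((1 - (1 - p)) / (1 - (1 - p) ^ J) - p)"
proof -
  have "1 - (1 - p) ^ J \<noteq> 0"
    using power_less_one_iff[of "1 - p" J] assms by simp
  then show ?thesis
    by (simp add: mean_payout_star_def Let_def field_simps)
qed

lemma parrondo_effect_if_less:
  assumes "0 < p\<^sub>A" "p\<^sub>A < p\<^sub>B" "p\<^sub>B < 1" "2 \<le> J" "0 < \<gamma>" "\<gamma> < 1"
  shows "parrondo_effect J p\<^sub>A \<mu>\<^sub>A p\<^sub>B \<mu>\<^sub>B \<gamma>"
proof -
  define f where "f = (\<lambda>q::real. (1 - q) / (1 - q ^ J))"
  define p where "p = mix \<gamma> p\<^sub>A p\<^sub>B"
  have "0 < \<gamma> * (p\<^sub>B - p\<^sub>A)" "0 < (1 - \<gamma>) * (p\<^sub>B - p\<^sub>A)" using assms by simp_all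
  then have p: "0 < p" "p < 1"
    using assms(1,3) by (simp_all add: p_def mix_def algebra_simps)
  \<comment> \<open>Passing to loss probabilities reverses the order: \<open>1 - p\<^sub>B\<close>
    is the left endpoint, so its weight \<open>1 - \<gamma>\<close> comes first.\<close>
  have "f ((1 - \<gamma>) * (1 - p\<^sub>B) + (1 - (1 - \<gamma>)) * (1 - p\<^sub>A))
      < (1 - \<gamma>) * f (1 - p\<^sub>B) + (1 - (1 - \<gamma>)) * f (1 - p\<^sub>A)"
    unfolding f_def using assms by (intro bonus_strictly_convex) auto
  also have "(1 - \<gamma>) * (1 - p\<^sub>B) + (1 - (1 - \<gamma>)) * (1 - p\<^sub>A) = 1 - p"
    by (simp add: p_def mix_def algebra_simps)
  finally have less: "real J * f (1 - p) < real J * (\<gamma> * f (1 - p\<^sub>A) + (1 - \<gamma>) * f (1 - p\<^sub>B))"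
    using assms by simp
  have star: "mean_payout_star J x \<mu> = \<mu> + real J * (f (1 - x) - x)"
    if "0 < x" "x < 1" for x \<mu>
    using that assms by (simp add: f_def mean_payout_star_eq)
  have "mean_payout_star J p\<^sub>A \<mu>\<^sub>A = \<mu>\<^sub>A + real J * (f (1 - p\<^sub>A) - p\<^sub>A)"
    "mean_payout_star J p\<^sub>B \<mu>\<^sub>B = \<mu>\<^sub>B + real J * (f (1 - p\<^sub>B) - p\<^sub>B)"
    using assms by (simp_all add: star)
  moreover have "mean_payout_star J p (mix \<gamma> \<mu>\<^sub>A \<mu>\<^sub>B)
      = mix \<gamma> \<mu>\<^sub>A \<mu>\<^sub>B + real J * f (1 - p) - real J * mix \<gamma> p\<^sub>A p\<^sub>B"
    using p by (simp add: star right_diff_distrib) (simp add: p_def)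
  \<comment> \<open>The mean payouts and the terms \<open>- J * p\<close> are affine under mixing
    and cancel, leaving \<open>less\<close>.\<close>
  ultimately show ?thesis
    using less unfolding parrondo_effect_def mixture_payout_star_def p_def[symmetric]
    by (simp only:) (simp add: p_def mix_def algebra_simps)
qed

text \<open>Relabelling the arms covers the case where \<open>p\<^sub>B\<close> is the smaller win
  probability.\<close>

lemma parrondo_effect_commute:
  "parrondo_effect J p\<^sub>A \<mu>\<^sub>A p\<^sub>B \<mu>\<^sub>B \<gamma> \<longleftrightarrow> parrondo_effect J p\<^sub>B \<mu>\<^sub>B p\<^sub>A \<mu>\<^sub>A (1 - \<gamma>)"
  by (simp add: parrondo_effect_def mixture_payout_star_def mix_def add.commute)

theorem theorem4:
  fixes p\<^sub>A p\<^sub>B \<mu>\<^sub>A \<mu>\<^sub>B \<gamma> :: real and J :: nat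
  assumes "0 < p\<^sub>A" and "p\<^sub>A < 1" and "0 < p\<^sub>B" and "p\<^sub>B < 1"
    and "0 \<le> \<mu>\<^sub>A" and "0 \<le> \<mu>\<^sub>B"
    and "p\<^sub>A \<noteq> p\<^sub>B" and "2 \<le> J" and "0 < \<gamma>" and "\<gamma> < 1"
  shows "parrondo_effect J p\<^sub>A \<mu>\<^sub>A p\<^sub>B \<mu>\<^sub>B \<gamma>"
proof (cases "p\<^sub>A < p\<^sub>B")
  case True
  then show ?thesis using assms by (intro parrondo_effect_if_less)
next
  case False
  then have "parrondo_effect J p\<^sub>B \<mu>\<^sub>B p\<^sub>A \<mu>\<^sub>A (1 - \<gamma>)"
    using assms by (intro parrondo_effect_if_less) auto
  then show ?thesis using parrondo_effect_commute by blast
qed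

end
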